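(* Let $N\ge1$ and let $\{t_i\}_{i=0}^N$ and $\{T_i\}_{i=0}^N$ be sequences of positive real numbers satisfying $t_i^2\le2T_i=2\sum_{j=0}^it_j$ for $0\le i\le N-1$ and $t_N^2\le T_N=\sum_{j=0}^Nt_j$. Let $f:\mathbb{R}^d\to\mathbb{R}$ be $L$-smooth convex ($L>0$) with $f_\star=\inf f>-\infty$, and write $z^+=z-\frac1L\nabla f(z)$. Then the H-dual of the fixed-step first-order method $$x_{k+1}=x_k^++\frac{(T_k-t_k)t_{k+1}}{t_kT_{k+1}}(x_k^+-x_{k-1}^+)+\frac{(t_k^2-T_k)t_{k+1}}{t_kT_{k+1}}(x_k^+-x_k),\quad k=0,\dots,N-1,\quad x_{-1}^+=x_0,$$ is $$y_{k+1}=y_k^++\frac{T_{N-k-1}(t_{N-k-1}-1)}{T_{N-k}(t_{N-k}-1)}(y_k^+-y_{k-1}^+)+\frac{(t_{N-k}^2-T_{N-k})(t_{N-k-1}-1)}{T_{N-k}(t_{N-k}-1)}(y_k^+-y_k),\quad k=0,\dots,N-1,\quad y_{-1}^+=y_0,$$ and it exhibits the rate $$\frac1{2L}\|\nabla f(y_N)\|^2\le\frac1{T_N}\big(f(y_0)-f_\star\big).$$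
   Context: A function is $L$-smooth convex if it is convex and differentiable with $L$-Lipschitz gradient. An $N$-step fixed-step first-order method (FSFOM) with lower triangular matrix $H\in\mathbb{R}^{N\times N}$, $H_{k+1,i+1}=h_{k+1,i}$ for $0\le i\le k\le N-1$, is $x_{k+1}=x_k-\frac1L\sum_{i=0}^kh_{k+1,i}\nabla f(x_i)$, $k=0,\dots,N-1$, for any initial point $x_0\in\mathbb{R}^d$. The anti-transpose of $H$ is $(H^A)_{i,j}=H_{N-j+1,N-i+1}$. The H-dual of the FSFOM with $H$ is the FSFOM with $H^A$; its iterates are denoted $y_k$. *)

theory Defs
  imports "HOL-Analysis.Analysis" "Jordan_Normal_Form.Matrix"
begin

definition gradient :: "('a::real_inner \<Rightarrow> real) \<Rightarrow> 'a \<Rightarrow> 'a" where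
  "gradient f x = (THE D. GDERIV f x :> D)"

lemma gradient_eqI:
  assumes "GDERIV f x :> D"
  shows "gradient f x = D"
  unfolding gradient_def
proof (rule the_equality)
  show "GDERIV f x :> D" by (rule assms)
next
  fix D' assume "GDERIV f x :> D'"
  then have "(\<lambda>h. h \<bullet> D') = (\<lambda>h. h \<bullet> D)"
    using assms has_derivative_unique unfolding gderiv_def by blast
  then have "\<forall>h. h \<bullet> D' = h \<bullet> D"
    by (simp add: fun_eq_iff)
  then show "D' = D"
    by (simp only: vector_eq_ldot)
qed

lemma GDERIV_gradient:
  fixes f :: "'a::euclidean_space \<Rightarrow> real"
  assumes "f differentiable (at x)"
  shows "GDERIV f x :> gradient f x"
proof -
  from assms obtain f' where f': "(f has_derivative f') (at x)"
    by (auto simp: differentiable_def)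
  then have lin: "linear f'"
    by (rule has_derivative_linear)
  have "f' = (\<lambda>h. h \<bullet> adjoint f' 1)"
    using adjoint_works[OF lin] by (auto simp: fun_eq_iff)
  with f' have "GDERIV f x :> adjoint f' 1"
    by (simp add: gderiv_def)
  then show ?thesis
    by (simp add: gradient_eqI)
qed

definition smooth_convex :: "real \<Rightarrow> ('a::euclidean_space \<Rightarrow> real) \<Rightarrow> bool" where
  "smooth_convex L f \<longleftrightarrow>
     convex_on UNIV f \<and> (\<forall>x. f differentiable (at x)) \<and> L-lipschitz_on UNIV (gradient f)"

text \<open>
  An \<open>N\<close>-step first-order method is a relation \<open>M L g x\<close> between the smoothness constant \<open>L\<close>,
  the gradients \<open>g 0, g 1, \<dots>\<close> and the iterates \<open>x 0, x 1, \<dots>\<close>.  Running it on \<open>f\<close>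
  means taking \<open>g i = gradient f (x i)\<close>.  Only the values \<open>g i\<close> with \<open>i < N\<close> and \<open>x k\<close>
  with \<open>k \<le> N\<close> matter.
\<close>

type_synonym 'a first_order_method = "real \<Rightarrow> (nat \<Rightarrow> 'a) \<Rightarrow> (nat \<Rightarrow> 'a) \<Rightarrow> bool"

definition lower_triangular_mats :: "nat \<Rightarrow> real mat set" where
  "lower_triangular_mats N = {H \<in> carrier_mat N N. upper_triangular (transpose_mat H)}"

text \<open>Matrix entries are counted from 0, so \<open>H $$ (k, i)\<close> is the step size \<open>h\<^sub>k\<^sub>+\<^sub>1\<^sub>,\<^sub>i\<close>.\<close>

definition fsfom :: "nat \<Rightarrow> real mat \<Rightarrow> 'a::real_vector first_order_method" where
  "fsfom N H L g x \<longleftrightarrow>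
     (\<forall>k<N. x (Suc k) = x k - (1 / L) *\<^sub>R (\<Sum>i\<le>k. (H $$ (k, i)) *\<^sub>R g i))"

definition anti_transpose :: "real mat \<Rightarrow> real mat" where
  "anti_transpose H = mat (dim_col H) (dim_row H)
     (\<lambda>(i, j). H $$ (dim_row H - 1 - j, dim_col H - 1 - i))"

text \<open>
  \<open>has_step_matrix N H M\<close>: the method \<open>M\<close> is the FSFOM with matrix \<open>H\<close>.  The gradients are
  treated as formal symbols, i.e. as arbitrary vectors.  This determines \<open>H\<close>, whereas the
  iterates for actual functions need not: if \<open>x 1 = x 0\<close> for every \<open>f\<close>, then the first two
  gradients always coincide and their coefficients cannot be told apart.
\<close>

definition has_step_matrix :: "nat \<Rightarrow> real mat \<Rightarrow> 'a::real_vector first_order_method \<Rightarrow> bool" where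
  "has_step_matrix N H M \<longleftrightarrow>
     H \<in> lower_triangular_mats N \<and> (\<forall>L>0. \<forall>g x. M L g x \<longleftrightarrow> fsfom N H L g x)"

definition grad_step :: "real \<Rightarrow> (nat \<Rightarrow> 'a) \<Rightarrow> (nat \<Rightarrow> 'a) \<Rightarrow> nat \<Rightarrow> 'a::real_vector" where
  "grad_step L g x k = x k - (1 / L) *\<^sub>R g k"

text \<open>The point \<open>x\<^sub>k\<^sub>-\<^sub>1\<^sup>+\<close>, with the convention that it is \<open>x\<^sub>0\<close> for \<open>k = 0\<close>.\<close>

definition prev_grad_step :: "real \<Rightarrow> (nat \<Rightarrow> 'a) \<Rightarrow> (nat \<Rightarrow> 'a) \<Rightarrow> nat \<Rightarrow> 'a::real_vector" where
  "prev_grad_step L g x k = (if k = 0 then x 0 else grad_step L g x (k - 1))"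

definition primal_method ::
  "nat \<Rightarrow> (nat \<Rightarrow> real) \<Rightarrow> (nat \<Rightarrow> real) \<Rightarrow> 'a::real_vector first_order_method" where
  "primal_method N t T L g x \<longleftrightarrow>
     (\<forall>k<N. x (k + 1) = grad_step L g x k
        + ((T k - t k) * t (k + 1) / (t k * T (k + 1)))
            *\<^sub>R (grad_step L g x k - prev_grad_step L g x k)
        + (((t k)\<^sup>2 - T k) * t (k + 1) / (t k * T (k + 1)))
            *\<^sub>R (grad_step L g x k - x k))"

text \<open>
  The quotients in the next recursion are meaningful only if \<open>t i \<noteq> 1\<close> for \<open>1 \<le> i \<le> N\<close>
  (recall \<open>z / 0 = 0\<close>).
\<close>

definition dual_method ::
  "nat \<Rightarrow> (nat \<Rightarrow> real) \<Rightarrow> (nat \<Rightarrow> real) \<Rightarrow> 'a::real_vector first_order_method" where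
  "dual_method N t T L g y \<longleftrightarrow>
     (\<forall>k<N. y (k + 1) = grad_step L g y k
        + (T (N - k - 1) * (t (N - k - 1) - 1) / (T (N - k) * (t (N - k) - 1)))
            *\<^sub>R (grad_step L g y k - prev_grad_step L g y k)
        + (((t (N - k))\<^sup>2 - T (N - k)) * (t (N - k - 1) - 1) / (T (N - k) * (t (N - k) - 1)))
            *\<^sub>R (grad_step L g y k - y k))"

end

(* The momentum recursions of both methods telescope: with H = I + (lower triangular part of m w^T),
   the primal method has m_k = t_{k+1} / (T_k T_{k+1}) and w_i = (t_i - 1) T_i, and the dual recursion
   unfolds to the anti-transpose of this matrix.

   For the rate, put v_i = 1 / T_{N-i} and let [x, y] <= 0 denote the inequality
   f(y) - f(x) + <grad f(y), x - y> + |grad f(x) - grad f(y)|^2 / (2 L) <= 0 of smooth convexity.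
   In the sum of v_{i+1} [y_i, y_{i+1}] and (v_{i+1} - v_i) [y_N, y_i] over i < N the function values
   telescope to v_0 (f(y_N) - f(y_0)).  The remaining quadratic form in the gradients is bounded below
   by completing squares one iterate at a time, each square having a coefficient proportional to
   2 - t_{N-i}^2 / T_{N-i} >= 0.  The gradient step from y_N accounts for f(y_N) - inf f. *)
theory Submission
  imports Defs
begin

no_notation Matrix.scalar_prod (infix \<open>\<bullet>\<close> 70)

section \<open>Inequalities for smooth convex functions\<close>

lemma smooth_convex_GDERIV:
  assumes "smooth_convex L f"
  shows "GDERIV f x :> gradient f x"
  using assms by (simp add: smooth_convex_def GDERIV_gradient)

lemma GDERIV_along_line:
  assumes "GDERIV f (x + s *\<^sub>R d) :> D"
  shows "((\<lambda>s. f (x + s *\<^sub>R d)) has_real_derivative d \<bullet> D) (at s)"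
proof -
  have "((\<lambda>s. x + s *\<^sub>R d) has_derivative (\<lambda>s. s *\<^sub>R d)) (at s)"
    by (auto intro!: derivative_eq_intros)
  from has_derivative_compose[OF this assms[unfolded gderiv_def]]
  show ?thesis
    by (simp add: has_field_derivative_def mult_commute_abs)
qed

text \<open>Restricting \<open>f\<close> to the line through \<open>y\<close> and \<open>z\<close>
  reduces this to the tangent inequality for convex functions of one real variable.\<close>

lemma convex_on_gradient_le:
  assumes "convex_on UNIV f" "GDERIV f y :> D"
  shows "f y + D \<bullet> (z - y) \<le> f z"
proof -
  define \<phi> where "\<phi> = (\<lambda>s::real. f (y + s *\<^sub>R (z - y)))"
  have "convex_on UNIV \<phi>"
  proof (intro convex_onI)
    fix a b c :: real assume "0 < c" "c < 1"
    have "y + ((1 - c) *\<^sub>R a + c *\<^sub>R b) *\<^sub>R (z - y)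
        = (1 - c) *\<^sub>R (y + a *\<^sub>R (z - y)) + c *\<^sub>R (y + b *\<^sub>R (z - y))"
      by (simp add: algebra_simps)
    then show "\<phi> ((1 - c) *\<^sub>R a + c *\<^sub>R b) \<le> (1 - c) * \<phi> a + c * \<phi> b"
      unfolding \<phi>_def using convex_onD[OF assms(1), of c] \<open>0 < c\<close> \<open>c < 1\<close> by simp
  qed auto
  moreover have "(\<phi> has_real_derivative (z - y) \<bullet> D) (at 0)"
    unfolding \<phi>_def by (rule GDERIV_along_line) (simp add: assms)
  ultimately have "\<phi> 1 - \<phi> 0 \<ge> (z - y) \<bullet> D * (1 - 0)"
    by (intro convex_on_imp_above_tangent[of UNIV]) auto
  then show ?thesis by (simp add: \<phi>_def inner_commute)
qed

text \<open>Along the segment from \<open>x\<close> to \<open>z\<close>, subtract from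
  \<open>f\<close> its linear part at \<open>x\<close> and the quadratic bound. By Cauchy-Schwarz
  and the Lipschitz gradient the remainder has nonpositive derivative.\<close>

lemma smooth_descent:
  assumes "smooth_convex L f"
  shows "f z \<le> f x + gradient f x \<bullet> (z - x) + L / 2 * (norm (z - x))\<^sup>2"
proof -
  define d where "d = z - x"
  define \<phi> where "\<phi> = (\<lambda>s. f (x + s *\<^sub>R d) - s * (d \<bullet> gradient f x) - s\<^sup>2 * (L / 2 * (d \<bullet> d)))"
  have "\<phi> 1 \<le> \<phi> 0"
  proof (rule DERIV_nonpos_imp_nonincreasing[of 0 1 \<phi>])
    fix s :: real assume s: "0 \<le> s" "s \<le> 1"
    let ?D = "d \<bullet> gradient f (x + s *\<^sub>R d) - d \<bullet> gradient f x - 2 * s * (L / 2 * (d \<bullet> d))"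
    have "(\<phi> has_real_derivative ?D) (at s)"
      unfolding \<phi>_def
      by (auto intro!: derivative_eq_intros GDERIV_along_line smooth_convex_GDERIV[OF assms])
    moreover have "?D \<le> 0"
    proof -
      have "dist (gradient f (x + s *\<^sub>R d)) (gradient f x) \<le> L * dist (x + s *\<^sub>R d) x"
        using assms unfolding smooth_convex_def by (auto intro: lipschitz_onD)
      then have "norm (gradient f (x + s *\<^sub>R d) - gradient f x) \<le> L * (s * norm d)"
        using s by (simp add: dist_norm)
      then have "norm d * norm (gradient f (x + s *\<^sub>R d) - gradient f x)
          \<le> norm d * (L * (s * norm d))"
        by (rule mult_left_mono) simp
      then have "d \<bullet> (gradient f (x + s *\<^sub>R d) - gradient f x) \<le> norm d * (L * (s * norm d))"
        using norm_cauchy_schwarz order_trans by blast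
      then show ?thesis
        by (simp add: inner_diff_right dot_square_norm power2_eq_square algebra_simps)
    qed
    ultimately show "\<exists>y. (\<phi> has_real_derivative y) (at s) \<and> y \<le> 0" by blast
  qed simp
  then show ?thesis
    by (simp add: \<phi>_def d_def dot_square_norm inner_commute)
qed

text \<open>The value of \<open>f\<close> at one auxiliary point is bounded below by the tangent at
  \<open>y\<close> and above by the quadratic bound at \<open>x\<close>. The result is scaled by
  \<open>L\<close> to match the form used in \<open>dual_rate\<close>.\<close>

lemma smooth_convex_gradient_gap:
  assumes "smooth_convex L f" "L > 0"
  shows "L * (f y - f x) + L * (gradient f y \<bullet> (x - y))
    + 1 / 2 * (norm (gradient f x - gradient f y))\<^sup>2 \<le> 0"
proof -
  define e where "e = gradient f x - gradient f y"
  \<comment> \<open>This \<open>z\<close> minimises the quadratic upper bound at \<open>x\<close>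
    minus the tangent at \<open>y\<close>, so comparing the two there gives the strongest
    inequality.\<close>
  define z where "z = x - (1 / L) *\<^sub>R e"
  have "f y + gradient f y \<bullet> (z - y) \<le> f z"
    using assms by (intro convex_on_gradient_le smooth_convex_GDERIV[OF assms(1)]) (simp add: smooth_convex_def)
  also have "\<dots> \<le> f x + gradient f x \<bullet> (z - x) + L / 2 * (norm (z - x))\<^sup>2"
    by (rule smooth_descent[OF assms(1)])
  also have "gradient f y \<bullet> (z - y) = gradient f y \<bullet> (x - y) - (gradient f y \<bullet> e) / L"
    by (simp add: z_def inner_diff_right)
  also have "gradient f x \<bullet> (z - x) = - (gradient f x \<bullet> e) / L"
    by (simp add: z_def)
  also have "L / 2 * (norm (z - x))\<^sup>2 = (e \<bullet> e) / (2 * L)"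
    using assms(2) by (simp add: z_def power_divide dot_square_norm power2_eq_square)
  finally have "f y + gradient f y \<bullet> (x - y) - (gradient f y \<bullet> e) / L
      \<le> f x - (gradient f x \<bullet> e) / L + (e \<bullet> e) / (2 * L)"
    by simp
  moreover have "gradient f x \<bullet> e = gradient f y \<bullet> e + e \<bullet> e"
    by (simp add: e_def inner_diff_left)
  ultimately have "f y + gradient f y \<bullet> (x - y) + (e \<bullet> e) / (2 * L) \<le> f x"
    by (simp add: add_divide_distrib)
  then have "L * (f y + gradient f y \<bullet> (x - y) + (e \<bullet> e) / (2 * L)) \<le> L * f x"
    using assms(2) by (intro mult_left_mono) simp_all
  then show ?thesis
    using assms(2) by (simp add: e_def[symmetric] dot_square_norm algebra_simps)
qed

text \<open>The infimum is at most the value after a gradient step from \<open>x\<close>, which is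
  lower than \<open>f x\<close> by at least the squared gradient norm over
  \<open>2 * L\<close>.\<close>

lemma smooth_convex_INF_gap:
  assumes "smooth_convex L f" "L > 0" "bdd_below (range f)"
  shows "1 / 2 * (norm (gradient f x))\<^sup>2 \<le> L * (f x - (INF x. f x))"
proof -
  let ?g = "gradient f x"
  have "(INF x. f x) \<le> f (x - (1 / L) *\<^sub>R ?g)"
    using assms(3) by (intro cINF_lower) auto
  also have "\<dots> \<le> f x - (?g \<bullet> ?g) / (2 * L)"
    using smooth_descent[OF assms(1), of "x - (1 / L) *\<^sub>R ?g" x] assms(2)
    by (simp add: power_mult_distrib dot_square_norm power2_eq_square field_simps)
  finally show ?thesis
    using assms(2) by (simp add: dot_square_norm field_simps)
qed

section \<open>Step matrices\<close>

text \<open>If the part of \<open>H\<close> besides the identity factors as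
  \<open>m k * w i\<close>, all past gradients enter a step through one weighted sum. This is the
  common normal form of the primal method and its dual.\<close>

lemma fsfom_rank_one_iff:
  assumes "\<And>k i. i \<le> k \<Longrightarrow> k < N \<Longrightarrow> H $$ (k, i) = (if i = k then 1 else 0) + m k * w i"
  shows "fsfom N H L g x \<longleftrightarrow>
    (\<forall>k<N. x (Suc k) = x k - (1 / L) *\<^sub>R (g k + m k *\<^sub>R (\<Sum>i\<le>k. w i *\<^sub>R g i)))"
proof -
  have "(\<Sum>i\<le>k. (H $$ (k, i)) *\<^sub>R g i) = g k + m k *\<^sub>R (\<Sum>i\<le>k. w i *\<^sub>R g i)" if "k < N" for k
  proof -
    have "(\<Sum>i\<le>k. (H $$ (k, i)) *\<^sub>R g i)
        = (\<Sum>i\<le>k. (if i = k then g i else 0) + m k *\<^sub>R (w i *\<^sub>R g i))"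
      using that by (intro sum.cong) (auto simp: assms scaleR_add_left)
    then show ?thesis
      by (simp add: sum.distrib scaleR_sum_right)
  qed
  then show ?thesis by (simp add: fsfom_def)
qed

text \<open>The momentum difference contains the previous step, hence the old weighted sum with
  factor \<open>m k\<close>. Multiplying by \<open>a (Suc k)\<close> turns this factor into
  \<open>m (Suc k)\<close>, and \<open>a + b\<close> supplies the new summand. At
  \<open>k = 0\<close> the convention for \<open>prev_grad_step\<close> makes both differences equal
  to \<open>- (1 / L) *\<^sub>R g 0\<close>.\<close>

lemma momentum_iff:
  fixes g x :: "nat \<Rightarrow> 'a::real_vector"
  assumes "\<And>k. Suc k < N \<Longrightarrow> a (Suc k) * m k = m (Suc k)"
    and "\<And>k. k < N \<Longrightarrow> a k + b k = m k * w k"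
  shows "(\<forall>k<N. x (k + 1) = grad_step L g x k
        + a k *\<^sub>R (grad_step L g x k - prev_grad_step L g x k)
        + b k *\<^sub>R (grad_step L g x k - x k)) \<longleftrightarrow>
    (\<forall>k<N. x (Suc k) = x k - (1 / L) *\<^sub>R (g k + m k *\<^sub>R (\<Sum>i\<le>k. w i *\<^sub>R g i)))"
    (is "(\<forall>k<N. x (k + 1) = ?P k) \<longleftrightarrow> (\<forall>k<N. x (Suc k) = ?Q k)")
proof -
  have zero: "?P 0 = ?Q 0" if "0 < N"
  proof -
    have "?P 0 = x 0 - (1 / L) *\<^sub>R (g 0 + (a 0 + b 0) *\<^sub>R g 0)"
      by (simp add: grad_step_def prev_grad_step_def algebra_simps)
    then show ?thesis using that by (simp add: assms(2))
  qed
  have step: "?P (Suc k) = ?Q (Suc k)" if "Suc k < N" and x: "x (Suc k) = ?Q k" for k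
  proof -
    define S where "S = (\<Sum>i\<le>k. w i *\<^sub>R g i)"
    have "grad_step L g x (Suc k) - prev_grad_step L g x (Suc k)
        = - (1 / L) *\<^sub>R (g (Suc k) + m k *\<^sub>R S)"
      by (simp add: grad_step_def prev_grad_step_def x S_def algebra_simps)
    then have "?P (Suc k) = x (Suc k)
        - (1 / L) *\<^sub>R (g (Suc k) + (a (Suc k) + b (Suc k)) *\<^sub>R g (Suc k) + (a (Suc k) * m k) *\<^sub>R S)"
      by (simp only:) (simp add: grad_step_def algebra_simps)
    also have "\<dots> = ?Q (Suc k)"
      unfolding assms(1)[OF that(1)] assms(2)[OF that(1)] sum.atMost_Suc S_def[symmetric]
      by (simp only: scaleR_add_right scaleR_scaleR add.assoc add.commute[of "m (Suc k) *\<^sub>R S"])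
    finally show ?thesis .
  qed
  show ?thesis
  proof (intro iffI allI impI)
    fix k assume P: "\<forall>k<N. x (k + 1) = ?P k" and "k < N"
    from \<open>k < N\<close> show "x (Suc k) = ?Q k"
    proof (induction k)
      case 0
      then have "x (0 + 1) = ?P 0" using P by blast
      also have "\<dots> = ?Q 0" using 0 by (rule zero)
      finally show ?case by simp
    next
      case (Suc k)
      then have "x (Suc k + 1) = ?P (Suc k)" using P by blast
      also have "\<dots> = ?Q (Suc k)" using Suc by (intro step) auto
      finally show ?case by simp
    qed
  next
    fix k assume Q: "\<forall>k<N. x (Suc k) = ?Q k" and "k < N"
    have "?P k = ?Q k"
    proof (cases k)
      case 0
      then show ?thesis using zero \<open>k < N\<close> by blast
    next
      case (Suc j)
      have "?P (Suc j) = ?Q (Suc j)"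
      proof (rule step)
        show "Suc j < N" using \<open>k < N\<close> Suc by simp
        then show "x (Suc j) = ?Q j" using Q Suc_lessD by blast
      qed
      then show ?thesis unfolding Suc .
    qed
    moreover have "x (Suc k) = ?Q k" using Q \<open>k < N\<close> by blast
    ultimately have "x (Suc k) = ?P k" by (rule trans[OF _ sym, rotated])
    then show "x (k + 1) = ?P k" by (simp only: Suc_eq_plus1)
  qed
qed

text \<open>Since gradients are arbitrary vectors, a sequence that is nonzero only at index
  \<open>j\<close> reads off the entry \<open>(k, j)\<close> from step \<open>k\<close>.\<close>

lemma has_step_matrix_unique:
  assumes "has_step_matrix N H (M :: 'a::euclidean_space first_order_method)"
    and "has_step_matrix N H' M"
  shows "H = H'"
proof -
  have carrier: "H \<in> carrier_mat N N" "H' \<in> carrier_mat N N"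
    and upper: "upper_triangular (transpose_mat H)" "upper_triangular (transpose_mat H')"
    using assms by (auto simp: has_step_matrix_def lower_triangular_mats_def)
  obtain v :: 'a where "v \<noteq> 0"
    using nonempty_Basis nonzero_Basis by blast
  have "H $$ (k, j) = H' $$ (k, j)" if "k < N" "j < N" for k j
  proof (cases "j \<le> k")
    case True
    define g where "g = (\<lambda>i. if i = j then v else 0)"
    define x where "x = rec_nat 0 (\<lambda>k x. x - (\<Sum>i\<le>k. (H $$ (k, i)) *\<^sub>R g i))"
    have "fsfom N H 1 g x"
      by (simp add: fsfom_def x_def)
    then have "fsfom N H' 1 g x"
      using assms by (simp add: has_step_matrix_def)
    then have "(\<Sum>i\<le>k. (H $$ (k, i)) *\<^sub>R g i) = (\<Sum>i\<le>k. (H' $$ (k, i)) *\<^sub>R g i)"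
      using \<open>fsfom N H 1 g x\<close> \<open>k < N\<close> by (simp add: fsfom_def)
    moreover have "(\<Sum>i\<le>k. c i *\<^sub>R g i) = c j *\<^sub>R v" for c :: "nat \<Rightarrow> real"
      using True by (simp add: g_def if_distrib[of "scaleR _"] cong: if_cong)
    ultimately show ?thesis using \<open>v \<noteq> 0\<close> by simp
  next
    case False
    then have "transpose_mat H $$ (j, k) = 0" "transpose_mat H' $$ (j, k) = 0"
      using that carrier by (auto simp del: index_transpose_mat
          intro!: upper_triangularD[OF upper(1)] upper_triangularD[OF upper(2)])
    then show ?thesis using that carrier by simp
  qed
  then show ?thesis using carrier by (intro eq_matI) auto
qed

lemma anti_transpose_lower_triangular:
  assumes "H \<in> lower_triangular_mats N"
  shows "anti_transpose H \<in> lower_triangular_mats N"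
proof -
  have H: "dim_row H = N" "dim_col H = N" "upper_triangular (transpose_mat H)"
    using assms by (auto simp: lower_triangular_mats_def)
  have "H $$ (i, j) = 0" if "i < j" "j < N" for i j
    using upper_triangularD[OF H(3), of i j] that H by simp
  then show ?thesis
    using H(1,2) by (auto simp: lower_triangular_mats_def anti_transpose_def upper_triangular_def)
qed

section \<open>Matrices of the primal method and of its dual\<close>

definition primal_matrix :: "nat \<Rightarrow> (nat \<Rightarrow> real) \<Rightarrow> (nat \<Rightarrow> real) \<Rightarrow> real mat" where
  "primal_matrix N t T = mat N N (\<lambda>(k, i). (if i = k then 1 else 0)
     + (if i \<le> k then t (Suc k) / (T k * T (Suc k)) * ((t i - 1) * T i) else 0))"

lemma primal_matrix_lower_triangular: "primal_matrix N t T \<in> lower_triangular_mats N"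
  by (auto simp: primal_matrix_def lower_triangular_mats_def upper_triangular_def)

text \<open>Anti-transposition reverses the indices and exchanges the row factor with the column
  factor, so the rank-one form survives.\<close>

lemma anti_transpose_primal_matrix_nth:
  assumes "i \<le> k" "k < N"
  shows "anti_transpose (primal_matrix N t T) $$ (k, i) = (if i = k then 1 else 0)
    + (t (N - Suc k) - 1) * T (N - Suc k) * (t (N - i) / (T (N - Suc i) * T (N - i)))"
proof -
  have "N - Suc k = N - Suc i \<longleftrightarrow> i = k" "Suc (N - Suc i) = N - i"
    using assms by auto
  then show ?thesis
    using assms by (auto simp: anti_transpose_def primal_matrix_def)
qed

lemma fsfom_anti_transpose_primal_matrix_iff:
  "fsfom N (anti_transpose (primal_matrix N t T)) L g y \<longleftrightarrow>
    (\<forall>k<N. y (Suc k) = y k - (1 / L) *\<^sub>R (g k + ((t (N - Suc k) - 1) * T (N - Suc k)) *\<^sub>R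
      (\<Sum>i\<le>k. (t (N - i) / (T (N - Suc i) * T (N - i))) *\<^sub>R g i)))"
  by (rule fsfom_rank_one_iff) (rule anti_transpose_primal_matrix_nth)

lemma primal_method_step_matrix:
  assumes t: "\<forall>i\<le>N. t i > 0" and T: "\<forall>i\<le>N. T i = (\<Sum>j\<le>i. t j)"
  shows "has_step_matrix N (primal_matrix N t T) (primal_method N t T)"
proof -
  have pos: "T i > 0" if "i \<le> N" for i
    using that t T by (auto intro!: sum_pos)
  have rec: "T (Suc k) = T k + t (Suc k)" if "k < N" for k
    using that T by simp
  define m where "m = (\<lambda>k. t (Suc k) / (T k * T (Suc k)))"
  define w where "w = (\<lambda>i. (t i - 1) * T i)"
  define a where "a = (\<lambda>k. (T k - t k) * t (k + 1) / (t k * T (k + 1)))"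
  define b where "b = (\<lambda>k. ((t k)\<^sup>2 - T k) * t (k + 1) / (t k * T (k + 1)))"
  \<comment> \<open>The numerator factor \<open>T (Suc k) - t (Suc k)\<close> equals
    \<open>T k\<close> and cancels against the denominator of \<open>m k\<close>.\<close>
  have 1: "a (Suc k) * m k = m (Suc k)"
    if "Suc k < N" for k
  proof -
    have "T k > 0" "T (Suc k) > 0" "t (Suc k) > 0" using t pos that by auto
    then show ?thesis using rec[of k] that by (simp add: a_def m_def)
  qed
  \<comment> \<open>In the sum of the numerators \<open>T k\<close> drops out and
    \<open>t k * (t k - 1)\<close> remains.\<close>
  have 2: "a k + b k = m k * w k" if "k < N" for k
  proof -
    have "t k > 0" "T k > 0" using t pos that by auto
    then show ?thesis
      by (simp add: a_def b_def m_def w_def add_divide_distrib[symmetric] power2_eq_square)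
         (simp add: algebra_simps divide_simps)
  qed
  have "fsfom N (primal_matrix N t T) L g x \<longleftrightarrow> primal_method N t T L g x"
    for L and g x :: "nat \<Rightarrow> 'a"
  proof -
    have "fsfom N (primal_matrix N t T) L g x \<longleftrightarrow>
        (\<forall>k<N. x (Suc k) = x k - (1 / L) *\<^sub>R (g k + m k *\<^sub>R (\<Sum>i\<le>k. w i *\<^sub>R g i)))"
      by (rule fsfom_rank_one_iff) (auto simp: primal_matrix_def m_def w_def)
    moreover have "primal_method N t T L g x \<longleftrightarrow>
        (\<forall>k<N. x (Suc k) = x k - (1 / L) *\<^sub>R (g k + m k *\<^sub>R (\<Sum>i\<le>k. w i *\<^sub>R g i)))"
      using momentum_iff[of N a m b w x L g, OF 1 2] unfolding primal_method_def a_def b_def .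
    ultimately show ?thesis by blast
  qed
  then show ?thesis
    by (simp add: has_step_matrix_def primal_matrix_lower_triangular)
qed

lemma dual_method_step_matrix:
  assumes t: "\<forall>i\<le>N. t i > 0" and T: "\<forall>i\<le>N. T i = (\<Sum>j\<le>i. t j)"
    and ne: "\<forall>i\<in>{1..N}. t i \<noteq> 1"
  shows "has_step_matrix N (anti_transpose (primal_matrix N t T)) (dual_method N t T)"
proof -
  have pos: "T i > 0" if "i \<le> N" for i
    using that t T by (auto intro!: sum_pos)
  define m where "m = (\<lambda>k. (t (N - Suc k) - 1) * T (N - Suc k))"
  define w where "w = (\<lambda>i. t (N - i) / (T (N - Suc i) * T (N - i)))"
  define a where "a = (\<lambda>k. T (N - k - 1) * (t (N - k - 1) - 1) / (T (N - k) * (t (N - k) - 1)))"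
  define b where "b = (\<lambda>k. ((t (N - k))\<^sup>2 - T (N - k)) * (t (N - k - 1) - 1)
    / (T (N - k) * (t (N - k) - 1)))"
  \<comment> \<open>Here \<open>N - Suc k\<close> is at least 1, so \<open>ne\<close> makes the
    cancelled factor \<open>t (N - Suc k) - 1\<close> nonzero.\<close>
  have 1: "a (Suc k) * m k = m (Suc k)" if "Suc k < N" for k
  proof -
    have "T (N - Suc k) > 0" "t (N - Suc k) \<noteq> 1" using that ne pos by auto
    then show ?thesis by (simp add: a_def m_def)
  qed
  have 2: "a k + b k = m k * w k" if "k < N" for k
  proof -
    define j where "j = N - Suc k"
    have j: "N - k = Suc j" "N - k - 1 = j" "N - Suc k = j" "j < N" using that by (auto simp: j_def)
    have "T j > 0" "T (Suc j) > 0" "t (Suc j) - 1 \<noteq> 0" 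
      using pos ne \<open>j < N\<close> by auto
    moreover have "T (Suc j) = T j + t (Suc j)"
      using T \<open>j < N\<close> by simp
    moreover from this have "T j + ((t (Suc j))\<^sup>2 - T (Suc j)) = t (Suc j) * (t (Suc j) - 1)"
      by (simp add: power2_eq_square algebra_simps)
    then have "T j * (t j - 1) + ((t (Suc j))\<^sup>2 - T (Suc j)) * (t j - 1)
        = t (Suc j) * (t (Suc j) - 1) * (t j - 1)"
      by (metis distrib_right)
    ultimately show ?thesis
      by (simp add: a_def b_def m_def w_def j add_divide_distrib[symmetric])
  qed
  have "dual_method N t T L g y \<longleftrightarrow> fsfom N (anti_transpose (primal_matrix N t T)) L g y"
    for L and g y :: "nat \<Rightarrow> 'a"
    using momentum_iff[of N a m b w y L g, OF 1 2]
    unfolding fsfom_anti_transpose_primal_matrix_iff dual_method_def a_def b_def m_def w_def .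
  then show ?thesis
    by (simp add: has_step_matrix_def primal_matrix_lower_triangular anti_transpose_lower_triangular)
qed

section \<open>The rate of the dual method\<close>

text \<open>The right side minus the left is \<open>(1 - s\<^sup>2 * p / 2) / p\<close> times the
  squared norm of \<open>p *\<^sub>R g - S\<close>. In \<open>dual_rate\<close> the vector on the
  left is the next weighted sum divided by the next weight.\<close>

lemma potential_decrease:
  fixes p s :: real and S g :: "'a::real_inner"
  assumes "p > 0" "s\<^sup>2 * p \<le> 2"
  shows "1 / 2 * (norm ((1 / p - s) *\<^sub>R S + (s * p) *\<^sub>R g))\<^sup>2
    \<le> 1 / 2 * (norm S / p)\<^sup>2 - (s - 1) / p * (norm S)\<^sup>2 + p * (norm g)\<^sup>2 + (s - 2) * (S \<bullet> g)"
proof -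
  define Z X G where "Z = S \<bullet> S" and "X = S \<bullet> g" and "G = g \<bullet> g"
  have "(norm ((1 / p - s) *\<^sub>R S + (s * p) *\<^sub>R g))\<^sup>2
      = (1 / p - s)\<^sup>2 * Z + 2 * (1 / p - s) * (s * p) * X + (s * p)\<^sup>2 * G"
    unfolding dot_square_norm[symmetric] Z_def X_def G_def
    by (simp add: inner_add_left inner_add_right inner_commute power2_eq_square)
  moreover have "(norm (p *\<^sub>R g - S))\<^sup>2 = p\<^sup>2 * G - 2 * p * X + Z"
    unfolding dot_square_norm[symmetric] Z_def X_def G_def
    by (simp add: inner_diff_left inner_diff_right inner_commute power2_eq_square)
  ultimately have "1 / 2 * (norm S / p)\<^sup>2 - (s - 1) / p * (norm S)\<^sup>2 + p * (norm g)\<^sup>2 + (s - 2) * (S \<bullet> g)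
      - 1 / 2 * (norm ((1 / p - s) *\<^sub>R S + (s * p) *\<^sub>R g))\<^sup>2
      = (1 - s\<^sup>2 * p / 2) / p * (norm (p *\<^sub>R g - S))\<^sup>2"
    unfolding power_divide dot_square_norm[symmetric] Z_def[symmetric] X_def[symmetric] G_def[symmetric]
    using assms(1) by (simp add: power2_eq_square divide_simps) (simp add: algebra_simps)
  moreover have "0 \<le> (1 - s\<^sup>2 * p / 2) / p * (norm (p *\<^sub>R g - S))\<^sup>2"
    using assms by simp
  ultimately show ?thesis by linarith
qed

text \<open>The estimate isolated from \<open>f\<close>: only the pairwise gap inequalities and the
  recursion for \<open>y\<close> enter. It is applied with \<open>N = Suc n\<close>,
  \<open>v i = 1 / T (N - i)\<close> and \<open>s i = t (N - i)\<close>. The final gradient term on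
  the right is later absorbed by the gap between \<open>f (y N)\<close> and the infimum.\<close>

lemma dual_rate:
  fixes g y :: "nat \<Rightarrow> 'a::real_inner" and F v s :: "nat \<Rightarrow> real"
  assumes L: "L > 0"
    and gap: "\<And>i j. i \<le> Suc n \<Longrightarrow> j \<le> Suc n \<Longrightarrow>
      L * (F j - F i) + L * (g j \<bullet> (y i - y j)) + 1 / 2 * (norm (g i - g j))\<^sup>2 \<le> 0"
    and v: "\<And>i. i \<le> Suc n \<Longrightarrow> v i > 0"
    and v_Suc: "\<And>i. i \<le> n \<Longrightarrow> 1 / v (Suc i) = 1 / v i - s i"
    and s_nonneg: "\<And>i. i \<le> n \<Longrightarrow> 0 \<le> s i"
    and s_last: "s (Suc n) = 1 / v (Suc n)"
    and s_le: "\<And>i. i \<le> Suc n \<Longrightarrow> (s i)\<^sup>2 * v i \<le> 2"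
    and s_0: "(s 0)\<^sup>2 * v 0 \<le> 1"
    and y_Suc: "\<And>k. k \<le> n \<Longrightarrow> y (Suc k) = y k - (1 / L) *\<^sub>R
      (g k + ((s (Suc k) - 1) / v (Suc k)) *\<^sub>R (\<Sum>i\<le>k. (v (Suc i) - v i) *\<^sub>R g i))"
  shows "1 / 2 * (norm (g (Suc n)))\<^sup>2
    \<le> L * v 0 * (F 0 - F (Suc n)) + v 0 / 2 * (norm (g (Suc n)))\<^sup>2"
proof -
  define h where "h = g (Suc n)"
  define S where "S = (\<lambda>k. \<Sum>i\<le>k. (v (Suc i) - v i) *\<^sub>R g i)"
  define c where "c = (\<lambda>k. (s (Suc k) - 1) / v (Suc k))"
  have S_Suc: "S (Suc k) = S k + (v (Suc (Suc k)) - v (Suc k)) *\<^sub>R g (Suc k)" for k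
    by (simp add: S_def)
  have step: "L *\<^sub>R (y k - y (Suc k)) = g k + c k *\<^sub>R S k" if "k \<le> n" for k
    using that L by (simp add: y_Suc S_def c_def)
  have v_ratio: "(v (Suc i) - v i) / v (Suc i) = s i * v i" if "i \<le> n" for i
    using v_Suc[OF that] v[of i] v[of "Suc i"] that by (simp add: field_simps)
  have diff_pos: "v (Suc i) - v i = s i * v i * v (Suc i)" if "i \<le> n" for i
    using v_ratio[OF that] v[of "Suc i"] that by (simp add: field_simps)
  have nonneg: "0 \<le> v (Suc i) - v i" if "i \<le> n" for i
    unfolding diff_pos[OF that] using v[of i] v[of "Suc i"] s_nonneg[OF that] that by simp
  have pc: "v (Suc k) * c k = s (Suc k) - 1" if "k \<le> n" for k
    using v[of "Suc k"] that by (simp add: c_def)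
  have gap_step: "v (Suc k) * (L * (F (Suc k) - F k)) + v (Suc k) * (g (Suc k) \<bullet> g k)
      + (s (Suc k) - 1) * (S k \<bullet> g (Suc k))
      + 1 / 2 * v (Suc k) * (g k \<bullet> g k - 2 * (g (Suc k) \<bullet> g k) + g (Suc k) \<bullet> g (Suc k)) \<le> 0"
    if "k \<le> n" for k
  proof -
    have "L * (g (Suc k) \<bullet> (y k - y (Suc k))) = g (Suc k) \<bullet> g k + c k * (S k \<bullet> g (Suc k))"
      using arg_cong[OF step[OF that], of "\<lambda>z. g (Suc k) \<bullet> z"]
      by (simp add: inner_add_right inner_commute)
    then have "v (Suc k) * (L * (F (Suc k) - F k) + (g (Suc k) \<bullet> g k + c k * (S k \<bullet> g (Suc k)))
        + 1 / 2 * (norm (g k - g (Suc k)))\<^sup>2) \<le> 0"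
      using gap[of k "Suc k"] v[of "Suc k"] that by (simp add: mult_nonneg_nonpos)
    moreover have "v (Suc k) * (c k * (S k \<bullet> g (Suc k))) = (s (Suc k) - 1) * (S k \<bullet> g (Suc k))"
      by (simp add: pc[OF that, symmetric])
    moreover have "(norm (g k - g (Suc k)))\<^sup>2
        = g k \<bullet> g k - 2 * (g (Suc k) \<bullet> g k) + g (Suc k) \<bullet> g (Suc k)"
      by (simp add: dot_square_norm[symmetric] inner_diff_left inner_diff_right inner_commute)
    ultimately show ?thesis by (simp add: distrib_left)
  qed
  have gap_last: "(v (Suc k) - v k) * (L * (F k - F (Suc n)))
      + (v (Suc k) - v k) * (L * (g k \<bullet> (y (Suc n) - y k)))
      + 1 / 2 * (v (Suc k) - v k) * (h \<bullet> h - 2 * (g k \<bullet> h) + g k \<bullet> g k) \<le> 0"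
    if "k \<le> n" for k
  proof -
    have "(v (Suc k) - v k) * (L * (F k - F (Suc n)) + L * (g k \<bullet> (y (Suc n) - y k))
        + 1 / 2 * (norm (h - g k))\<^sup>2) \<le> 0"
      using gap[of "Suc n" k] nonneg[OF that] that unfolding h_def by (simp add: mult_nonneg_nonpos)
    moreover have "(norm (h - g k))\<^sup>2 = h \<bullet> h - 2 * (g k \<bullet> h) + g k \<bullet> g k"
      by (simp add: dot_square_norm[symmetric] inner_diff_left inner_diff_right inner_commute)
    ultimately show ?thesis by (simp add: distrib_left)
  qed
  have potential: "1 / 2 * (norm ((1 / v (Suc k) - s (Suc k)) *\<^sub>R S k
        + (s (Suc k) * v (Suc k)) *\<^sub>R g (Suc k)))\<^sup>2
      \<le> 1 / 2 * (norm (S k) / v (Suc k))\<^sup>2 - c k * (S k \<bullet> S k)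
        + v (Suc k) * (g (Suc k) \<bullet> g (Suc k)) + (s (Suc k) - 2) * (S k \<bullet> g (Suc k))"
    if "k \<le> n" for k
    using potential_decrease[of "v (Suc k)" "s (Suc k)" "S k" "g (Suc k)"]
      v[of "Suc k"] s_le[of "Suc k"] that by (simp add: c_def dot_square_norm)
  \<comment> \<open>Moves the base point from \<open>y k\<close> to \<open>y (Suc k)\<close>, so
    that the invariant at \<open>k\<close> can be added to \<open>gap_last\<close> at
    \<open>Suc k\<close>.\<close>
  have split_last: "L * (S k \<bullet> (y (Suc n) - y k))
      = L * (S k \<bullet> (y (Suc n) - y (Suc k))) - S k \<bullet> g k - c k * (S k \<bullet> S k)" if "k \<le> n" for k
  proof -
    have "L * (S k \<bullet> (y k - y (Suc k))) = S k \<bullet> g k + c k * (S k \<bullet> S k)"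
      using arg_cong[OF step[OF that], of "\<lambda>z. S k \<bullet> z"] by (simp add: inner_add_right)
    then show ?thesis by (simp add: inner_diff_right algebra_simps)
  qed
  \<comment> \<open>Obtained by summing the first \<open>k\<close> of \<open>gap_step\<close> and the first \<open>k + 1\<close> of \<open>gap_last\<close>;
    the norm of \<open>S k\<close> bounds the quadratic terms in the gradients seen so far.\<close>
  have inv: "L * (S k \<bullet> (y (Suc n) - y k)) - S k \<bullet> h + 1 / 2 * (v (Suc k) - v 0) * (h \<bullet> h)
      + 1 / 2 * (norm (S k) / v (Suc k))\<^sup>2 + S k \<bullet> g k - 1 / 2 * v (Suc k) * (g k \<bullet> g k)
    \<le> L * (v 0 * F 0 - v (Suc k) * F k + (v (Suc k) - v 0) * F (Suc n))" if "k \<le> n" for k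
    using that
  proof (induction k)
    \<comment> \<open>Comparison with \<open>gap_last\<close> at 0 leaves half of
      \<open>v 0 * (g 0 \<bullet> g 0)\<close> to dominate the squared norm of
      \<open>S 0 / v 1\<close>; this is where the stricter bound \<open>s_0\<close> enters.\<close>
    case 0
    have "(norm (S 0) / v (Suc 0))\<^sup>2 = ((v (Suc 0) - v 0) / v (Suc 0))\<^sup>2 * (g 0 \<bullet> g 0)"
      by (simp add: S_def power_mult_distrib power_divide dot_square_norm)
    also have "\<dots> = (s 0 * v 0)\<^sup>2 * (g 0 \<bullet> g 0)"
      by (simp add: v_ratio)
    also have "\<dots> \<le> v 0 * (g 0 \<bullet> g 0)"
    proof (rule mult_right_mono)
      have "(s 0)\<^sup>2 * v 0 * v 0 \<le> 1 * v 0"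
        using s_0 v[of 0] by (intro mult_right_mono) auto
      then show "(s 0 * v 0)\<^sup>2 \<le> v 0" by (simp add: power2_eq_square ac_simps)
    qed simp
    finally show ?case
      using gap_last[of 0] by (simp add: S_def algebra_simps)
  next
    case (Suc k)
    then have k: "k \<le> n" by simp
    let ?p = "v (Suc k)" and ?q = "v (Suc (Suc k))" and ?g = "g (Suc k)" and ?S = "S (Suc k)"
    \<comment> \<open>Identifies the vector in \<open>potential\<close> as \<open>S (Suc k)\<close>
      divided by \<open>?q\<close>, using \<open>1 / ?q = 1 / ?p - s (Suc k)\<close> and
      \<open>(?q - ?p) / ?q = s (Suc k) * ?p\<close>.\<close>
    have "(1 / ?q) *\<^sub>R ?S = (1 / ?q) *\<^sub>R S k + ((?q - ?p) / ?q) *\<^sub>R ?g"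
      by (simp add: S_Suc scaleR_add_right)
    also have "\<dots> = (1 / ?p - s (Suc k)) *\<^sub>R S k + (s (Suc k) * ?p) *\<^sub>R ?g"
      using v_ratio v_Suc Suc.prems by presburger
    finally have "norm ((1 / ?p - s (Suc k)) *\<^sub>R S k + (s (Suc k) * ?p) *\<^sub>R ?g) = norm ?S / ?q"
      using v[of "Suc (Suc k)"] Suc.prems by (metis abs_of_pos divide_inverse_commute inverse_eq_divide
          norm_scaleR Suc_le_mono positive_imp_inverse_positive)
    with potential[OF k] have pot: "1 / 2 * (norm ?S / ?q)\<^sup>2
      \<le> 1 / 2 * (norm (S k) / ?p)\<^sup>2 - c k * (S k \<bullet> S k) + ?p * (?g \<bullet> ?g) + (s (Suc k) - 2) * (S k \<bullet> ?g)"
      by simp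
    have inner: "?S \<bullet> z = S k \<bullet> z + (?q - ?p) * (?g \<bullet> z)" for z
      by (simp add: S_Suc inner_add_left)
    show ?case
      using Suc.IH[OF k, unfolded split_last[OF k]] gap_step[OF k] gap_last[OF Suc.prems] pot
      unfolding inner by (simp add: algebra_simps)
  qed
  \<comment> \<open>By \<open>s_last\<close> the coefficient of \<open>S n\<close> in
    \<open>potential\<close> is 0 and that of \<open>h\<close> is 1, so its left side is the squared
    norm of the last gradient alone, halved.\<close>
  have "1 / 2 * (h \<bullet> h) \<le> 1 / 2 * (norm (S n) / v (Suc n))\<^sup>2 - c n * (S n \<bullet> S n)
      + v (Suc n) * (h \<bullet> h) + (s (Suc n) - 2) * (S n \<bullet> h)"
    using potential[of n] v[of "Suc n"] by (simp add: s_last h_def dot_square_norm)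
  then show ?thesis
    using inv[of n] split_last[of n] gap_step[of n]
    by (simp add: h_def[symmetric] dot_square_norm[symmetric] algebra_simps)
qed

text \<open>Unique existence of the step matrix makes the H-dual well defined. Its explicit
  recursion is claimed where the quotients are meaningful, while the rate is stated for the
  anti-transposed matrix itself and so also covers \<open>t i = 1\<close>.\<close>

theorem corollary1:
  fixes N :: nat and t T :: "nat \<Rightarrow> real"
    and L :: real and f :: "real ^ 'd \<Rightarrow> real"
  assumes "N \<ge> 1"
    and "\<forall>i\<le>N. t i > 0" and "\<forall>i\<le>N. T i > 0"
    and "\<forall>i\<le>N. T i = (\<Sum>j\<le>i. t j)"
    and "\<forall>i<N. (t i)\<^sup>2 \<le> 2 * T i"
    and "(t N)\<^sup>2 \<le> T N"
    and "L > 0" and "smooth_convex L f" and "bdd_below (range f)"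
  shows "(\<exists>!H. has_step_matrix N H (primal_method N t T :: (real ^ 'd) first_order_method)) \<and>
    (\<forall>H. has_step_matrix N H (primal_method N t T :: (real ^ 'd) first_order_method) \<longrightarrow>
       ((\<forall>i\<in>{1..N}. t i \<noteq> 1) \<longrightarrow>
          has_step_matrix N (anti_transpose H)
            (dual_method N t T :: (real ^ 'd) first_order_method)) \<and>
       (\<forall>y. fsfom N (anti_transpose H) L (\<lambda>i. gradient f (y i)) y \<longrightarrow>
          1 / (2 * L) * (norm (gradient f (y N)))\<^sup>2
            \<le> 1 / T N * (f (y 0) - (INF x. f x))))"
proof -
  let ?H = "primal_matrix N t T"
  let ?primal = "primal_method N t T :: (real ^ 'd) first_order_method"
  have primal: "has_step_matrix N ?H ?primal"
    by (intro primal_method_step_matrix assms)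
  have unique: "H = ?H" if "has_step_matrix N H ?primal" for H
    using has_step_matrix_unique[OF that primal] .
  have dual: "has_step_matrix N (anti_transpose ?H) (dual_method N t T :: (real ^ 'd) first_order_method)"
    if "\<forall>i\<in>{1..N}. t i \<noteq> 1"
    using that by (intro dual_method_step_matrix assms)
  have rate: "1 / (2 * L) * (norm (gradient f (y N)))\<^sup>2 \<le> 1 / T N * (f (y 0) - (INF x. f x))"
    if y: "fsfom N (anti_transpose ?H) L (\<lambda>i. gradient f (y i)) y" for y
  proof -
    obtain n where N: "N = Suc n" using assms(1) by (cases N) auto
    define v s where "v = (\<lambda>i. 1 / T (N - i))" and "s = (\<lambda>i. t (N - i))"
    have T_Suc: "T (Suc k) = T k + t (Suc k)" if "k < N" for k
      using that assms(4) by simp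
    have T_diff: "T (N - i) = T (N - Suc i) + t (N - i)" if "i \<le> n" for i
      using T_Suc[of "N - Suc i"] that by (simp add: N Suc_diff_le)
    \<comment> \<open>Truncated subtraction keeps \<open>N - i\<close> at most \<open>N\<close> for
      every \<open>i\<close>.\<close>
    have pos: "T (N - i) > 0" "t (N - i) > 0" for i
      using assms(2,3) by simp_all
    \<comment> \<open>The column factors of the dual matrix are differences of consecutive
      reciprocals of \<open>T\<close>, that is, increments of \<open>v\<close>.\<close>
    have weights: "t (N - i) / (T (N - Suc i) * T (N - i)) = v (Suc i) - v i" if "i \<le> n" for i
      using pos[of i] pos[of "Suc i"] T_diff[OF that] by (simp add: v_def divide_simps)
    have "y (Suc k) = y k - (1 / L) *\<^sub>R (gradient f (y k)
        + ((s (Suc k) - 1) / v (Suc k)) *\<^sub>R (\<Sum>i\<le>k. (v (Suc i) - v i) *\<^sub>R gradient f (y i)))"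
      if "k \<le> n" for k
    proof -
      have "(\<Sum>i\<le>k. (t (N - i) / (T (N - Suc i) * T (N - i))) *\<^sub>R gradient f (y i))
          = (\<Sum>i\<le>k. (v (Suc i) - v i) *\<^sub>R gradient f (y i))"
        using that by (intro sum.cong) (simp_all add: weights)
      then show ?thesis
        using y[unfolded fsfom_anti_transpose_primal_matrix_iff] that
        by (simp add: N s_def v_def)
    qed
    then have "1 / 2 * (norm (gradient f (y (Suc n))))\<^sup>2
      \<le> L * v 0 * (f (y 0) - f (y (Suc n))) + v 0 / 2 * (norm (gradient f (y (Suc n))))\<^sup>2"
    proof (intro dual_rate[where F = "\<lambda>i. f (y i)" and s = s and v = v])
      show "1 / v (Suc i) = 1 / v i - s i" if "i \<le> n" for i
        using T_diff[OF that] by (simp add: v_def s_def)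
      show "(s i)\<^sup>2 * v i \<le> 2" for i
      proof (cases "i = 0")
        case True
        then show ?thesis using assms(6) pos[of 0] by (simp add: s_def v_def divide_simps)
      next
        case False
        then have "(t (N - i))\<^sup>2 \<le> 2 * T (N - i)" using assms(1,5) by simp
        then show ?thesis using pos[of i] by (simp add: s_def v_def divide_simps)
      qed
      show "(s 0)\<^sup>2 * v 0 \<le> 1"
        using assms(6) pos[of 0] by (simp add: s_def v_def)
      \<comment> \<open>Both sides are \<open>t 0\<close>, since \<open>T 0 = t 0\<close>.\<close>
      show "s (Suc n) = 1 / v (Suc n)"
        using assms(4) by (simp add: s_def v_def N)
    qed (use pos assms(7) smooth_convex_gradient_gap[OF assms(8,7)] in \<open>simp_all add: v_def s_def less_imp_le\<close>)
    \<comment> \<open>Bounding the gradient term by the gap to the infimum makes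
      \<open>f (y N)\<close> cancel.\<close>
    also have "\<dots> \<le> L * v 0 * (f (y 0) - f (y N)) + v 0 * (L * (f (y N) - (INF x. f x)))"
      using mult_left_mono[OF smooth_convex_INF_gap[OF assms(8,7,9), of "y N"], of "v 0"] pos[of 0]
      by (simp add: N v_def)
    also have "\<dots> = L * (1 / T N * (f (y 0) - (INF x. f x)))"
      by (simp add: v_def algebra_simps)
    finally show ?thesis
      using assms(7) by (simp add: N field_simps)
  qed
  show ?thesis
    using primal unique dual rate by blast
qed

end
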